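(* Let $0<\gamma<1$ and $\beta_1,\beta_2>0$. Entropy-regularized $\gamma$-discounted games have a value, which satisfies $\Psi(\mathcal{V})=\mathcal{V}$; that is, there is a vector $\mathcal{V}\in\mathbb{R}^{|\mathcal{X}|}$ with $\Psi(\mathcal{V})=\mathcal{V}$ such that for every initial distribution $\mu_1\in\Delta(\mathcal{X})$ $$\max_{\boldsymbol{\sigma}\in\Gamma_1}\ \min_{\boldsymbol{\tau}\in\Gamma_2}\Phi_\infty(\boldsymbol{\sigma},\boldsymbol{\tau})=\min_{\boldsymbol{\tau}\in\Gamma_2}\ \max_{\boldsymbol{\sigma}\in\Gamma_1}\Phi_\infty(\boldsymbol{\sigma},\boldsymbol{\tau})=\sum_{x_1\in\mathcal{X}}\mu_1(x_1)\mathcal{V}(x_1)$$ (in particular the value equals $\mathcal{V}(x_1)$ when the game starts from the state $x_1$). Furthermore, stationary strategies are sufficient for both players to attain the game value, i.e., $$\max_{\boldsymbol{\sigma}\in\Gamma_1}\ \min_{\boldsymbol{\tau}\in\Gamma_2}\Phi_\infty(\boldsymbol{\sigma},\boldsymbol{\tau})=\max_{\boldsymbol{\sigma}\in\Gamma_1^S}\ \min_{\boldsymbol{\tau}\in\Gamma_2^S}\Phi_\infty(\boldsymbol{\sigma},\boldsymbol{\tau}).$$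
   Context: **Game.** $\mathcal{X}$ (states), $\mathcal{U}$ (actions of player 1), $\mathcal{W}$ (actions of player 2) are finite nonempty sets; $\Delta(S)$ is the probability simplex over a finite set $S$. The transition kernel is $\mathcal{P}:\mathcal{X}\times\mathcal{U}\times\mathcal{W}\to\Delta(\mathcal{X})$, written $\mathcal{P}(x'|x,u,w)$. The stage payoff (made by player 2 to player 1) is a real-valued function $\mathcal{R}(x,u,w)$. At each stage $t=1,2,\dots$ both players observe the current state and simultaneously choose actions $u_t,w_t$; the next state is drawn from $\mathcal{P}(\cdot|x_t,u_t,w_t)$. Player 1 maximizes and player 2 minimizes the evaluation function. **Strategies.** For a sequence, $x^t=(x_1,\dots,x_t)$. The set of histories up to stage $t$ is $\mathcal{H}_t=(\mathcal{X}\times\mathcal{U}\times\mathcal{W})^{t-1}\times\mathcal{X}$, with elements $h_t=(x^t,u^{t-1},w^{t-1})$. A strategy of player 1 is $\boldsymbol{\sigma}=(\sigma_1,\sigma_2,\dots)$ with $\sigma_t:\mathcal{H}_t\to\Delta(\mathcal{U})$; a strategy of player 2 is $\boldsymbol{\tau}=(\tau_1,\tau_2,\dots)$ with $\tau_t:\mathcal{H}_t\to\Delta(\mathcal{W})$. A strategy is stationary if it depends only on the current state and not on the stage number, e.g. $\boldsymbol{\sigma}=(\sigma,\sigma,\dots)$ with $\sigma:\mathcal{X}\to\Delta(\mathcal{U})$. $\Gamma_i$ and $\Gamma_i^S$ denote the sets of all strategies and all stationary strategies of player $i\in\{1,2\}$. **Induced distribution.** Given $\mu_1\in\Delta(\mathcal{X})$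 and $(\boldsymbol{\sigma},\boldsymbol{\tau})$, the distribution of histories is defined by $\mu_{t+1}(x^{t+1},u^t,w^t)=\mathcal{P}(x_{t+1}|x_t,u_t,w_t)\,\sigma_t(u_t|h_t)\,\tau_t(w_t|h_t)\,\mu_t(h_t)$. All random variables $X_t,U_t,W_t$ below have this joint law, $\mathbb{E}$ denotes the corresponding expectation, and $H_t=(X^t,U^{t-1},W^{t-1})$. **Evaluation function.** With natural logarithms, $0\log 0=0$, and $H(\cdot|\cdot)$ the conditional Shannon entropy, $$\Phi_\infty(\boldsymbol{\sigma},\boldsymbol{\tau})=\sum_{t=1}^\infty\gamma^{t-1}\Big[\mathbb{E}\,\mathcal{R}(X_t,U_t,W_t)+\frac1{\beta_1}H(U_t|H_t)-\frac1{\beta_2}H(W_t|H_t)\Big].$$ **Shapley operator.** For $\mathcal{V}\in\mathbb{R}^{|\mathcal{X}|}$, $x\in\mathcal{X}$, $\sigma=\sigma(\cdot|x)\in\Delta(\mathcal{U})$, $\tau=\tau(\cdot|x)\in\Delta(\mathcal{W})$, let $$\mathcal{L}(\mathcal{V})(x,\sigma,\tau)=\mathbb{E}^{\sigma,\tau}\Big[\mathcal{R}(x,u,w)-\frac1{\beta_1}\log\sigma(u|x)+\frac1{\beta_2}\log\tau(w|x)+\gamma\sum_{x'\in\mathcal{X}}\mathcal{P}(x'|x,u,w)\mathcal{V}(x')\Big],$$ where $u\sim\sigma(\cdot|x)$ and $w\sim\tau(\cdot|x)$ are independent. The operator $\Psi:\mathbb{R}^{|\mathcal{X}|}\to\mathbb{R}^{|\mathcal{X}|}$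 is $\Psi(\mathcal{V})[x]=\max_{\sigma\in\Delta(\mathcal{U})}\min_{\tau\in\Delta(\mathcal{W})}\mathcal{L}(\mathcal{V})(x,\sigma,\tau)$. *)

theory Defs
  imports "HOL-Probability.Probability" "HOL-Real_Asymp.Real_Asymp"
begin

text \<open>
  The finite nonempty sets of states, actions of player 1 and actions of player 2 are the types
  \<open>'x\<close>, \<open>'u\<close>, \<open>'w\<close> of class \<open>finite\<close>; the simplex over a finite set is the corresponding type of
  probability mass functions.

  An element of $H_t = (X \times U \times W)^{t-1} \times X$ is a list of length $t-1$, oldest
  entry first, paired with the current state. Every such pair lies in exactly one $H_t$, so a
  sequence $(\sigma_t)_{t \ge 1}$ of maps on the sets $H_t$ is the same thing as a single function
  on all histories.
\<close>

type_synonym ('x, 'u, 'w) history = "('x \<times> 'u \<times> 'w) list \<times> 'x"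

type_synonym ('x, 'u, 'w, 'a) strategy = "('x, 'u, 'w) history \<Rightarrow> 'a pmf"

definition stationary :: "('x, 'u, 'w, 'a) strategy set" where
  "stationary = {s. \<exists>f. \<forall>h x. s (h, x) = f x}"

text \<open>
  Time is counted from 0 below: index \<open>t\<close> stands for stage $t+1$, so that the law of $H_{t+1}$
  lives on lists of length \<open>t\<close>. \<open>stage_law\<close> is the joint law of history and current actions.
\<close>

definition act ::
  "('x, 'u, 'w, 'u) strategy \<Rightarrow> ('x, 'u, 'w, 'w) strategy \<Rightarrow> ('x, 'u, 'w) history pmf
    \<Rightarrow> (('x, 'u, 'w) history \<times> 'u \<times> 'w) pmf" where
  "act \<sigma> \<tau> \<mu> =
    bind_pmf \<mu> (\<lambda>h. bind_pmf (\<sigma> h) (\<lambda>u. bind_pmf (\<tau> h) (\<lambda>w. return_pmf (h, u, w))))"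

primrec history_law ::
  "('x \<Rightarrow> 'u \<Rightarrow> 'w \<Rightarrow> 'x pmf) \<Rightarrow> 'x pmf \<Rightarrow> ('x, 'u, 'w, 'u) strategy \<Rightarrow> ('x, 'u, 'w, 'w) strategy
    \<Rightarrow> nat \<Rightarrow> ('x, 'u, 'w) history pmf" where
  "history_law P \<mu>1 \<sigma> \<tau> 0 = map_pmf (\<lambda>x. ([], x)) \<mu>1"
| "history_law P \<mu>1 \<sigma> \<tau> (Suc t) =
    bind_pmf (act \<sigma> \<tau> (history_law P \<mu>1 \<sigma> \<tau> t))
      (\<lambda>((h, x), u, w). map_pmf (\<lambda>x'. (h @ [(x, u, w)], x')) (P x u w))"

definition stage_law ::
  "('x \<Rightarrow> 'u \<Rightarrow> 'w \<Rightarrow> 'x pmf) \<Rightarrow> 'x pmf \<Rightarrow> ('x, 'u, 'w, 'u) strategy \<Rightarrow> ('x, 'u, 'w, 'w) strategy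
    \<Rightarrow> nat \<Rightarrow> (('x, 'u, 'w) history \<times> 'u \<times> 'w) pmf" where
  "stage_law P \<mu>1 \<sigma> \<tau> t = act \<sigma> \<tau> (history_law P \<mu>1 \<sigma> \<tau> t)"

text \<open>
  Conditional Shannon entropy $H(X | Y)$ in nats. Histories form an infinite countable type, so the
  count spaces are taken over whole types; \<open>cond_entropy_eq_sum\<close> below gives the finite sum.
\<close>

definition cond_entropy :: "'a pmf \<Rightarrow> ('a \<Rightarrow> 'b) \<Rightarrow> ('a \<Rightarrow> 'c) \<Rightarrow> real" where
  "cond_entropy p X Y =
    prob_space.conditional_entropy (measure_pmf p) (exp 1) (count_space UNIV) (count_space UNIV) X Y"

definition stage_payoff ::
  "('x::finite \<Rightarrow> 'u::finite \<Rightarrow> 'w::finite \<Rightarrow> 'x pmf) \<Rightarrow> ('x \<Rightarrow> 'u \<Rightarrow> 'w \<Rightarrow> real) \<Rightarrow> real \<Rightarrow> real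
    \<Rightarrow> 'x pmf \<Rightarrow> ('x, 'u, 'w, 'u) strategy \<Rightarrow> ('x, 'u, 'w, 'w) strategy \<Rightarrow> nat \<Rightarrow> real" where
  "stage_payoff P R \<beta>1 \<beta>2 \<mu>1 \<sigma> \<tau> t =
    (let p = stage_law P \<mu>1 \<sigma> \<tau> t in
      measure_pmf.expectation p (\<lambda>((h, x), u, w). R x u w)
      + 1 / \<beta>1 * cond_entropy p (\<lambda>(h, u, w). u) (\<lambda>(h, u, w). h)
      - 1 / \<beta>2 * cond_entropy p (\<lambda>(h, u, w). w) (\<lambda>(h, u, w). h))"

definition discounted_payoff ::
  "('x::finite \<Rightarrow> 'u::finite \<Rightarrow> 'w::finite \<Rightarrow> 'x pmf) \<Rightarrow> ('x \<Rightarrow> 'u \<Rightarrow> 'w \<Rightarrow> real) \<Rightarrow> real \<Rightarrow> real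
    \<Rightarrow> real \<Rightarrow> 'x pmf \<Rightarrow> ('x, 'u, 'w, 'u) strategy \<Rightarrow> ('x, 'u, 'w, 'w) strategy \<Rightarrow> real" where
  "discounted_payoff P R \<gamma> \<beta>1 \<beta>2 \<mu>1 \<sigma> \<tau> = (\<Sum>t. \<gamma> ^ t * stage_payoff P R \<beta>1 \<beta>2 \<mu>1 \<sigma> \<tau> t)"

text \<open>
  Max-min and min-max as attained extrema: \<open>has_maxmin f S T v\<close> says that all inner minima
  exist, that the outer maximum exists, and that the resulting number is \<open>v\<close>.
\<close>

definition has_min :: "('a \<Rightarrow> real) \<Rightarrow> 'a set \<Rightarrow> real \<Rightarrow> bool" where
  "has_min f S m \<longleftrightarrow> (\<exists>x\<in>S. f x = m) \<and> (\<forall>x\<in>S. m \<le> f x)"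

definition has_max :: "('a \<Rightarrow> real) \<Rightarrow> 'a set \<Rightarrow> real \<Rightarrow> bool" where
  "has_max f S m \<longleftrightarrow> (\<exists>x\<in>S. f x = m) \<and> (\<forall>x\<in>S. f x \<le> m)"

definition has_maxmin :: "('a \<Rightarrow> 'b \<Rightarrow> real) \<Rightarrow> 'a set \<Rightarrow> 'b set \<Rightarrow> real \<Rightarrow> bool" where
  "has_maxmin f S T v \<longleftrightarrow> (\<exists>g. (\<forall>s\<in>S. has_min (\<lambda>t. f s t) T (g s)) \<and> has_max g S v)"

definition has_minmax :: "('a \<Rightarrow> 'b \<Rightarrow> real) \<Rightarrow> 'a set \<Rightarrow> 'b set \<Rightarrow> real \<Rightarrow> bool" where
  "has_minmax f S T v \<longleftrightarrow> (\<exists>g. (\<forall>t\<in>T. has_max (\<lambda>s. f s t) S (g t)) \<and> has_min g T v)"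

definition local_payoff ::
  "('x::finite \<Rightarrow> 'u::finite \<Rightarrow> 'w::finite \<Rightarrow> 'x pmf) \<Rightarrow> ('x \<Rightarrow> 'u \<Rightarrow> 'w \<Rightarrow> real) \<Rightarrow> real \<Rightarrow> real
    \<Rightarrow> real \<Rightarrow> ('x \<Rightarrow> real) \<Rightarrow> 'x \<Rightarrow> 'u pmf \<Rightarrow> 'w pmf \<Rightarrow> real" where
  "local_payoff P R \<gamma> \<beta>1 \<beta>2 V x \<sigma> \<tau> =
    measure_pmf.expectation (pair_pmf \<sigma> \<tau>)
      (\<lambda>(u, w). R x u w - 1 / \<beta>1 * ln (pmf \<sigma> u) + 1 / \<beta>2 * ln (pmf \<tau> w)
        + \<gamma> * (\<Sum>x'\<in>UNIV. pmf (P x u w) x' * V x'))"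

definition shapley ::
  "('x::finite \<Rightarrow> 'u::finite \<Rightarrow> 'w::finite \<Rightarrow> 'x pmf) \<Rightarrow> ('x \<Rightarrow> 'u \<Rightarrow> 'w \<Rightarrow> real) \<Rightarrow> real \<Rightarrow> real
    \<Rightarrow> real \<Rightarrow> ('x \<Rightarrow> real) \<Rightarrow> 'x \<Rightarrow> real" where
  "shapley P R \<gamma> \<beta>1 \<beta>2 V x = (THE v. has_maxmin (local_payoff P R \<gamma> \<beta>1 \<beta>2 V x) UNIV UNIV v)"

text \<open>
  The laws satisfy the recursion
  $\mu_{t+1}(x^{t+1},u^t,w^t) = P(x_{t+1}|x_t,u_t,w_t)\,\sigma_t(u_t|h_t)\,\tau_t(w_t|h_t)\,\mu_t(h_t)$.
\<close>

lemma pmf_bind_single: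
  assumes "\<And>b. b \<noteq> a \<Longrightarrow> pmf (f b) y = 0"
  shows "pmf (bind_pmf M f) y = pmf M a * pmf (f a) y"
proof -
  have "pmf (bind_pmf M f) y = (\<Sum>a\<in>{a}. pmf (f a) y * pmf M a)"
    unfolding pmf_bind by (rule integral_measure_pmf_real) (use assms in auto)
  then show ?thesis by simp
qed

lemma pmf_act: "pmf (act \<sigma> \<tau> \<mu>) (h, u, w) = pmf (\<sigma> h) u * pmf (\<tau> h) w * pmf \<mu> h"
proof -
  have 1: "pmf (bind_pmf (\<sigma> b) (\<lambda>u. bind_pmf (\<tau> b) (\<lambda>w. return_pmf (b, u, w)))) (h, u, w) =
      (if b = h then pmf (\<sigma> h) u * pmf (\<tau> h) w else 0)" for b
    by (subst pmf_bind_single[where a = u], simp add: pmf_eq_0_set_pmf,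
        subst pmf_bind_single[where a = w]) auto
  show ?thesis unfolding act_def
    by (subst pmf_bind_single[where a = h]) (auto simp: 1)
qed

lemma pmf_history_law_0: "pmf (history_law P \<mu>1 \<sigma> \<tau> 0) ([], x) = pmf \<mu>1 x"
  by (simp add: pmf_map_inj' inj_def)

lemma pmf_history_law_Suc:
  "pmf (history_law P \<mu>1 \<sigma> \<tau> (Suc t)) (h @ [(x, u, w)], x') =
    pmf (P x u w) x' * pmf (\<sigma> (h, x)) u * pmf (\<tau> (h, x)) w * pmf (history_law P \<mu>1 \<sigma> \<tau> t) (h, x)"
proof -
  let ?f = "\<lambda>((h, x), u, w). map_pmf (\<lambda>x'. (h @ [(x, u, w)], x')) (P x u w)"
  have "pmf (map_pmf (\<lambda>x'. (h @ [(x, u, w)], x')) (P x u w)) (h @ [(x, u, w)], x') = pmf (P x u w) x'"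
    by (rule pmf_map_inj') (auto simp: inj_def)
  then show ?thesis
    unfolding history_law.simps
    by (subst pmf_bind_single[where a = "((h, x), u, w)"])
      (auto simp: pmf_act pmf_eq_0_set_pmf split: prod.splits)
qed

lemma cond_entropy_eq_sum:
  fixes X :: "'a \<Rightarrow> 'b::countable" and Y :: "'a \<Rightarrow> 'c::countable"
  assumes "finite (set_pmf p)"
  shows "cond_entropy p X Y =
    - (\<Sum>z\<in>(\<lambda>a. (X a, Y a)) ` set_pmf p. pmf (map_pmf (\<lambda>a. (X a, Y a)) p) z *
        ln (pmf (map_pmf (\<lambda>a. (X a, Y a)) p) z / pmf (map_pmf Y p) (snd z)))"
proof -
  interpret information_space "measure_pmf p" "exp 1"
    by unfold_locales simp
  have c: "count_space (UNIV :: 'b set) \<Otimes>\<^sub>M count_space (UNIV :: 'c set) = count_space UNIV"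
    by (subst pair_measure_countable) auto
  have D: "distributed (measure_pmf p) (count_space UNIV) Z (\<lambda>x. ennreal (pmf (map_pmf Z p) x))"
    for Z :: "'a \<Rightarrow> 'd"
    unfolding distributed_def map_pmf_rep_eq[symmetric] by (auto simp: measure_pmf_eq_density)
  let ?q = "map_pmf (\<lambda>a. (X a, Y a)) p"
  have "cond_entropy p X Y =
    - (\<integral>(x, y). pmf ?q (x, y) * log (exp 1) (pmf ?q (x, y) / pmf (map_pmf Y p) y)
        \<partial>(count_space UNIV \<Otimes>\<^sub>M count_space UNIV))"
    unfolding cond_entropy_def
    by (rule conditional_entropy_generic_eq)
      (use D[of "\<lambda>a. (X a, Y a)"] in
        \<open>auto simp: sigma_finite_measure_count_space_countable c intro!: D\<close>)
  also have "\<dots> = - (\<integral>z. pmf ?q z * ln (pmf ?q z / pmf (map_pmf Y p) (snd z)) \<partial>count_space UNIV)"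
    unfolding c by (simp add: split_beta' log_def)
  also have "(\<integral>z. pmf ?q z * ln (pmf ?q z / pmf (map_pmf Y p) (snd z)) \<partial>count_space UNIV)
    = (\<integral>z. ln (pmf ?q z / pmf (map_pmf Y p) (snd z)) \<partial>measure_pmf ?q)"
    unfolding measure_pmf_eq_density[of ?q] by (subst integral_density) auto
  also have "\<dots> = (\<Sum>z\<in>(\<lambda>a. (X a, Y a)) ` set_pmf p. ln (pmf ?q z / pmf (map_pmf Y p) (snd z)) * pmf ?q z)"
    by (rule integral_measure_pmf_real) (use assms in auto)
  finally show ?thesis by (simp add: mult.commute)
qed

lemma has_max_unique: "has_max f S a \<Longrightarrow> has_max f S b \<Longrightarrow> a = b"
  unfolding has_max_def by (metis order_antisym)

lemma has_min_unique: "has_min f S a \<Longrightarrow> has_min f S b \<Longrightarrow> a = b"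
  unfolding has_min_def by (metis order_antisym)

lemma has_maxmin_unique:
  assumes "has_maxmin f S T a" "has_maxmin f S T b"
  shows "a = b"
proof -
  obtain g where g: "\<And>s. s \<in> S \<Longrightarrow> has_min (f s) T (g s)" "has_max g S a"
    using assms(1) by (auto simp: has_maxmin_def)
  obtain g' where g': "\<And>s. s \<in> S \<Longrightarrow> has_min (f s) T (g' s)" "has_max g' S b"
    using assms(2) by (auto simp: has_maxmin_def)
  have "g s = g' s" if "s \<in> S" for s
    using has_min_unique g(1) g'(1) that by blast
  then have "has_max g S b" using g'(2) by (auto simp: has_max_def)
  then show ?thesis using g(2) has_max_unique by blast
qed

text \<open>The extrema in the definition of \<open>shapley\<close> exist for every argument.\<close>

definition prob_vecs :: "(real ^ 'a::finite) set" where
  "prob_vecs = {v. (\<forall>i. 0 \<le> v $ i) \<and> (\<Sum>i\<in>UNIV. v $ i) = 1}"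

definition pmf_vec :: "'a::finite pmf \<Rightarrow> real ^ 'a" where
  "pmf_vec p = (\<chi> i. pmf p i)"

lemma range_pmf_vec: "range pmf_vec = (prob_vecs :: (real ^ 'a::finite) set)"
proof (intro equalityI subsetI)
  fix v :: "real ^ 'a" assume "v \<in> range pmf_vec"
  then show "v \<in> prob_vecs" by (auto simp: prob_vecs_def pmf_vec_def sum_pmf_eq_1)
next
  fix v :: "real ^ 'a" assume v: "v \<in> prob_vecs"
  then have "(\<integral>\<^sup>+ i. ennreal (v $ i) \<partial>count_space UNIV) = 1"
    by (auto simp: prob_vecs_def nn_integral_count_space_finite sum_ennreal)
  then have "v = pmf_vec (embed_pmf (\<lambda>i. v $ i))"
    using v by (auto simp: pmf_vec_def vec_eq_iff pmf_embed_pmf prob_vecs_def)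
  then show "v \<in> range pmf_vec" by blast
qed

lemma compact_prob_vecs: "compact (prob_vecs :: (real ^ 'a::finite) set)"
proof -
  have "prob_vecs \<subseteq> (cbox 0 1 :: (real ^ 'a) set)"
  proof
    fix v :: "real ^ 'a" assume v: "v \<in> prob_vecs"
    have "v $ i \<le> (\<Sum>i\<in>UNIV. v $ i)" for i
      by (rule member_le_sum) (use v in \<open>auto simp: prob_vecs_def\<close>)
    then show "v \<in> cbox 0 1" using v by (auto simp: prob_vecs_def mem_box_cart)
  qed
  then have "bounded (prob_vecs :: (real ^ 'a) set)"
    using bounded_cbox bounded_subset by blast
  moreover have eq: "(prob_vecs :: (real ^ 'a) set) = (\<Inter>i. {v :: real ^ 'a. 0 \<le> v $ i}) \<inter> {v. (\<Sum>i\<in>UNIV. v $ i) = 1}"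
    by (auto simp: prob_vecs_def)
  have "closed (prob_vecs :: (real ^ 'a) set)"
    unfolding eq by (auto intro!: closed_INT closed_Collect_le closed_Collect_eq continuous_intros)
  ultimately show ?thesis by (simp add: compact_eq_bounded_closed)
qed

lemma continuous_on_x_ln_x: "continuous_on {0..} (\<lambda>x::real. x * ln x)"
proof -
  have "((\<lambda>x::real. x * ln x) \<longlongrightarrow> 0) (at_right 0)"
    by real_asymp
  then have 0: "((\<lambda>x::real. x * ln x) \<longlongrightarrow> 0 * ln 0) (at 0 within {0..})"
    by (simp add: at_within_Ici_at_right)
  show ?thesis unfolding continuous_on_def
  proof
    fix x :: real assume "x \<in> {0..}"
    then consider "x = 0" | "x > 0" by fastforce
    then show "((\<lambda>x. x * ln x) \<longlongrightarrow> x * ln x) (at x within {0..})"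
      by cases (use 0 in \<open>auto intro!: tendsto_intros\<close>)
  qed
qed

lemma maxmin_compact:
  fixes f :: "'a::metric_space \<Rightarrow> 'b::metric_space \<Rightarrow> real"
  assumes "compact A" "A \<noteq> {}" "compact B" "B \<noteq> {}"
    and ca: "\<And>t. t \<in> B \<Longrightarrow> continuous_on A (\<lambda>s. f s t)"
    and cb: "\<And>s. s \<in> A \<Longrightarrow> continuous_on B (\<lambda>t. f s t)"
  shows "\<exists>v. has_maxmin f A B v"
proof -
  have "\<exists>m. has_min (f s) B m" if "s \<in> A" for s
    using continuous_attains_inf[OF assms(3,4) cb[OF that]] by (auto simp: has_min_def)
  then obtain g where g: "\<And>s. s \<in> A \<Longrightarrow> has_min (f s) B (g s)" by metis
  obtain t0 where t0: "t0 \<in> B" using assms(4) by blast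
  obtain s0 where s0: "s0 \<in> A" "\<And>s. s \<in> A \<Longrightarrow> f s t0 \<le> f s0 t0"
    using continuous_attains_sup[OF assms(1,2) ca[OF t0]] by blast
  have gle: "g s \<le> f s t" if "s \<in> A" "t \<in> B" for s t
    using g[OF that(1)] that(2) by (auto simp: has_min_def)
  have bdd: "bdd_above (g ` A)"
    by (rule bdd_aboveI[where M = "f s0 t0"]) (use gle t0 s0 in force)
  define M where "M = (SUP s\<in>A. g s)"
  have "\<exists>s\<in>A. M - 1 / real (Suc n) < g s" for n
    using less_cSUP_iff[OF assms(2) bdd, of "M - 1 / real (Suc n)"] by (simp add: M_def)
  then obtain p where p: "\<And>n. p n \<in> A" "\<And>n. M - 1 / real (Suc n) < g (p n)" by metis
  obtain s r where s: "s \<in> A" "strict_mono (r :: nat \<Rightarrow> nat)" "(p \<circ> r) \<longlonglongrightarrow> s"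
    using compact_imp_seq_compact[OF assms(1)] p(1) unfolding seq_compact_def by meson
  have "M \<le> f s t" if t: "t \<in> B" for t
  proof (rule LIMSEQ_le)
    show "(\<lambda>n. M - 1 / real (Suc (r n))) \<longlonglongrightarrow> M"
      using LIMSEQ_subseq_LIMSEQ[OF tendsto_diff[OF tendsto_const[of M] LIMSEQ_inverse_real_of_nat] s(2)]
      by (simp add: o_def field_simps inverse_eq_divide)
    show "(\<lambda>n. f ((p \<circ> r) n) t) \<longlonglongrightarrow> f s t"
      using ca[OF t] s p(1) unfolding continuous_on_sequentially by (auto simp: o_def)
    show "\<exists>N. \<forall>n\<ge>N. M - 1 / real (Suc (r n)) \<le> f ((p \<circ> r) n) t"
      using p gle t by (auto simp: o_def intro!: exI[of _ 0]) (meson less_imp_le order_trans)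
  qed
  then have "M \<le> g s" using g[OF s(1)] by (metis has_min_def)
  moreover have up: "g s \<le> M" if "s \<in> A" for s
    unfolding M_def using that bdd by (rule cSUP_upper)
  ultimately have "has_max g A M" using s(1) by (auto simp: has_max_def intro!: bexI[of _ s] antisym)
  then show ?thesis using g by (auto simp: has_maxmin_def)
qed

lemma has_maxmin_image:
  "has_maxmin f (a ` S) (b ` T) v \<Longrightarrow> has_maxmin (\<lambda>s t. f (a s) (b t)) S T v"
  unfolding has_maxmin_def
  by (elim exE, rule_tac x = "\<lambda>s. g (a s)" in exI) (auto simp: has_min_def has_max_def)

lemma local_payoff_has_maxmin:
  "\<exists>v. has_maxmin (local_payoff P R \<gamma> \<beta>1 \<beta>2 V x) UNIV UNIV v"
proof -
  define c where "c u w = R x u w + \<gamma> * (\<Sum>x'\<in>UNIV. pmf (P x u w) x' * V x')" for u w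
  define a b where "a = 1 / \<beta>1" and "b = 1 / \<beta>2"
  define F where "F s t = (\<Sum>u\<in>UNIV. \<Sum>w\<in>UNIV. s $ u * t $ w * c u w
      - a * (s $ u * ln (s $ u)) * t $ w + b * (t $ w * ln (t $ w)) * s $ u)" for s t
  have *: "continuous_on prob_vecs (\<lambda>v :: real ^ 'd::finite. v $ i * ln (v $ i))" for i
    by (rule continuous_on_compose2[OF continuous_on_x_ln_x])
      (auto simp: prob_vecs_def intro!: continuous_intros)
  have ne: "(prob_vecs :: (real ^ 'd::finite) set) \<noteq> {}"
    using range_pmf_vec by blast
  have "\<exists>v. has_maxmin F prob_vecs prob_vecs v"
    by (rule maxmin_compact)
      (auto simp: F_def compact_prob_vecs ne intro!: continuous_intros *)
  moreover have "local_payoff P R \<gamma> \<beta>1 \<beta>2 V x = (\<lambda>s t. F (pmf_vec s) (pmf_vec t))"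
  proof (intro ext)
    fix s t
    show "local_payoff P R \<gamma> \<beta>1 \<beta>2 V x s t = F (pmf_vec s) (pmf_vec t)"
      unfolding local_payoff_def a_def[symmetric] b_def[symmetric]
      by (subst integral_measure_pmf_real[where A = "UNIV \<times> UNIV"])
        (auto simp: F_def pmf_vec_def pmf_pair c_def sum.cartesian_product algebra_simps
          simp del: UNIV_Times_UNIV intro!: sum.cong)
  qed
  ultimately show ?thesis
    unfolding range_pmf_vec[symmetric] by (metis has_maxmin_image)
qed

lemma has_maxmin_shapley:
  "has_maxmin (local_payoff P R \<gamma> \<beta>1 \<beta>2 V x) UNIV UNIV (shapley P R \<gamma> \<beta>1 \<beta>2 V x)"
  unfolding shapley_def using local_payoff_has_maxmin has_maxmin_unique by (metis theI)

end

theory Submission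
  imports Defs
begin

text \<open>
  A bounded function \<open>W\<close> on histories turns each history \<open>h\<close> into a one-shot game: the payoff of an
  action pair is the stage reward plus \<open>\<gamma>\<close> times the expected value of \<open>W\<close> after the next
  transition, and the mixed actions carry the entropy bonuses. By the chain of conditional laws, the
  regularized stage payoff at time \<open>t\<close> plus \<open>\<gamma>\<close> times the expectation of \<open>W\<close> at time \<open>t + 1\<close> is
  the expectation at time \<open>t\<close> of the one-shot payoff
  (\<open>stage_payoff_plus_continuation\<close>). Hence if the actions prescribed at every history achieve a
  one-shot payoff of at least (at most) \<open>W h\<close>, then telescoping shows that the discounted payoff is
  at least (at most) the initial expectation of \<open>W\<close> (\<open>payoff_ge\<close>, \<open>payoff_le\<close>).

  Now restrict the mixed actions at each history \<open>h\<close> to sets \<open>S h\<close> and \<open>T h\<close> on which every one-shot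
  game has a saddle point. Assigning to \<open>W\<close> the saddle values of its one-shot games is a
  \<open>\<gamma>\<close>-contraction for the supremum norm; its fixed point satisfies both inequalities above, so the
  one-shot saddle points assemble into a saddle point of the whole game
  (\<open>ex_dynamic_saddle\<close>). If \<open>S\<close> and \<open>T\<close> depend on the current state only, then all shifts of \<open>W\<close>
  along a past are fixed points too, so by uniqueness \<open>W\<close>, and with it the chosen strategies, depend
  on the current state only.

  This is used with three choices of the sets. When both sets are everything, one-shot saddle points
  exist by Brouwer's theorem, because best responses are Gibbs distributions and depend continuously
  on the opponent's mixed action (\<open>ex_saddle_mixed_payoff\<close>); this gives \<open>V\<close> and a stationary saddle
  point. When \<open>S h\<close> (or \<open>T h\<close>) is the singleton prescribed by a given strategy, a one-shot saddle point
  is just a best response, and the result is an optimal reply to that strategy, stationary if the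
  strategy is. These replies show that the inner extrema are attained for every strategy of the
  opponent, not only at the saddle point.
\<close>

section \<open>Saddle points\<close>

definition saddle :: "('a \<Rightarrow> 'b \<Rightarrow> real) \<Rightarrow> 'a set \<Rightarrow> 'b set \<Rightarrow> 'a \<Rightarrow> 'b \<Rightarrow> bool" where
  "saddle f S T s t \<longleftrightarrow>
    s \<in> S \<and> t \<in> T \<and> (\<forall>s'\<in>S. f s' t \<le> f s t) \<and> (\<forall>t'\<in>T. f s t \<le> f s t')"

lemma saddle_has_maxmin:
  assumes "saddle f S T s t" "\<And>s. s \<in> S \<Longrightarrow> \<exists>m. has_min (f s) T m"
  shows "has_maxmin f S T (f s t)"
proof -
  obtain g where g: "\<And>s. s \<in> S \<Longrightarrow> has_min (f s) T (g s)"
    using assms(2) by metis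
  have "g s = f s t"
    using assms(1) g by (intro has_min_unique[of "f s" T]) (auto simp: saddle_def has_min_def)
  moreover have "g s' \<le> f s t" if "s' \<in> S" for s'
    using assms(1) g[OF that] that unfolding saddle_def has_min_def by (meson order_trans)
  ultimately show ?thesis
    using g assms(1) by (auto simp: has_maxmin_def has_max_def saddle_def intro!: exI[of _ g])
qed

lemma saddle_has_minmax:
  assumes "saddle f S T s t" "\<And>t. t \<in> T \<Longrightarrow> \<exists>m. has_max (\<lambda>s. f s t) S m"
  shows "has_minmax f S T (f s t)"
proof -
  obtain g where g: "\<And>t. t \<in> T \<Longrightarrow> has_max (\<lambda>s. f s t) S (g t)"
    using assms(2) by metis
  have "g t = f s t"
    using assms(1) g by (intro has_max_unique[of "\<lambda>s. f s t" S]) (auto simp: saddle_def has_max_def)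
  moreover have "f s t \<le> g t'" if "t' \<in> T" for t'
    using assms(1) g[OF that] that unfolding saddle_def has_max_def by (meson order_trans)
  ultimately show ?thesis
    using g assms(1) by (auto simp: has_minmax_def has_min_def saddle_def intro!: exI[of _ g])
qed

text \<open>
  Compare \<open>f\<close> and \<open>g\<close> at the crossed pair made of the maximizer for \<open>f\<close> and the minimizer for \<open>g\<close>.
  This makes saddle values nonexpansive in the payoff function, whatever saddle points are chosen.
\<close>

lemma saddle_value_le:
  assumes "saddle f S T s t" "saddle g S T s' t'"
    and "\<And>x y. x \<in> S \<Longrightarrow> y \<in> T \<Longrightarrow> f x y \<le> g x y + d"
  shows "f s t \<le> g s' t' + d"
proof -
  have "f s t \<le> f s t'" "f s t' \<le> g s t' + d" "g s t' \<le> g s' t'"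
    using assms unfolding saddle_def by auto
  then show ?thesis by linarith
qed

section \<open>Contractions of bounded functions\<close>

text \<open>
  Banach's theorem for the supremum distance on functions over an arbitrary set. The contraction
  property is stated with explicit pointwise bounds \<open>d\<close>, which makes sense for unbounded functions
  too, so no type of bounded functions has to be introduced.
\<close>

lemma sup_contraction_unique:
  fixes F :: "('a \<Rightarrow> real) \<Rightarrow> 'a \<Rightarrow> real"
  assumes q: "0 \<le> q" "q < 1"
    and contr: "\<And>f g d a. (\<And>b. \<bar>f b - g b\<bar> \<le> d) \<Longrightarrow> \<bar>F f a - F g a\<bar> \<le> q * d"
    and f: "F f = f" "\<And>a. \<bar>f a\<bar> \<le> B" and g: "F g = g" "\<And>a. \<bar>g a\<bar> \<le> C"
  shows "f = g"
proof
  fix a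
  have le: "\<bar>f b - g b\<bar> \<le> q ^ n * (B + C)" for b n
  proof (induction n arbitrary: b)
    case 0
    then show ?case using f(2)[of b] g(2)[of b] by simp
  next
    case (Suc n)
    have "\<bar>F f b - F g b\<bar> \<le> q * (q ^ n * (B + C))"
      by (rule contr) (rule Suc)
    then show ?case unfolding f(1) g(1) by (simp only: power_Suc mult.assoc)
  qed
  have "(\<lambda>n. q ^ n * (B + C)) \<longlonglongrightarrow> 0"
    using tendsto_mult_right[OF LIMSEQ_realpow_zero[OF q], of "B + C"] by simp
  then have "\<bar>f a - g a\<bar> \<le> 0"
    by (rule LIMSEQ_le_const) (use le in blast)
  then show "f a = g a" by simp
qed

lemma sup_contraction_fixpoint:
  fixes F :: "('a \<Rightarrow> real) \<Rightarrow> 'a \<Rightarrow> real"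
  assumes q: "0 \<le> q" "q < 1"
    and contr: "\<And>f g d a. (\<And>b. \<bar>f b - g b\<bar> \<le> d) \<Longrightarrow> \<bar>F f a - F g a\<bar> \<le> q * d"
    and bnd: "\<And>a. \<bar>F (\<lambda>_. 0) a\<bar> \<le> M"
  shows "\<exists>f B. F f = f \<and> (\<forall>a. \<bar>f a\<bar> \<le> B)"
proof -
  define g where "g n = (F ^^ n) (\<lambda>_. 0)" for n
  have g0: "g 0 = (\<lambda>_. 0)" and gS: "g (Suc n) = F (g n)" for n
    by (auto simp: g_def)
  (* the iterates from 0 converge because their increments D are dominated by a geometric series *)
  define D where "D n a = g (Suc n) a - g n a" for n a
  have D: "\<bar>D n a\<bar> \<le> q ^ n * M" for n a
  proof (induction n arbitrary: a)
    case 0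
    then show ?case using bnd by (simp add: D_def gS g0)
  next
    case (Suc n)
    have "\<bar>F (g (Suc n)) a - F (g n) a\<bar> \<le> q * (q ^ n * M)"
      by (rule contr) (rule Suc[unfolded D_def])
    then show ?case unfolding D_def gS[of "Suc n"] gS[of n] by (simp only: power_Suc mult.assoc)
  qed
  have sq: "summable (\<lambda>n. q ^ n * M)" using q by (simp add: summable_mult2)
  have sD: "summable (\<lambda>n. D n a)" for a
    by (rule summable_comparison_test'[OF sq]) (use D in auto)
  define f where "f a = (\<Sum>n. D n a)" for a
  have gsum: "g n a = (\<Sum>k<n. D k a)" for n a
    by (induction n) (auto simp: g0 D_def)
  define K where "K = (\<Sum>n. q ^ n * M)"
  have tail: "\<bar>f a - g n a\<bar> \<le> q ^ n * K" for a n
  proof -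
    have split: "f a - g n a = (\<Sum>k. D (k + n) a)"
      using suminf_split_initial_segment[OF sD, of a n] by (simp add: f_def gsum)
    have s: "summable (\<lambda>k. q ^ n * (q ^ k * M))" using sq by (rule summable_mult)
    have le: "norm (D (k + n) a) \<le> q ^ n * (q ^ k * M)" for k
      using D[of "k + n" a] by (simp add: power_add mult_ac)
    have "norm (f a - g n a) \<le> (\<Sum>k. q ^ n * (q ^ k * M))"
      unfolding split
    proof (rule norm_suminf_le)
      show "norm (D (k + n) a) \<le> q ^ n * (q ^ k * M)" for k by (rule le)
    qed (rule s)
    also have "\<dots> = q ^ n * K" unfolding K_def using sq by (rule suminf_mult)
    finally show ?thesis by simp
  qed
  have "F f a = f a" for a
  proof -
    have le: "\<bar>F f a - f a\<bar> \<le> 2 * (q * (q ^ n * K))" for n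
    proof -
      have "\<bar>F f a - F (g n) a\<bar> \<le> q * (q ^ n * K)"
        by (rule contr) (rule tail)
      moreover have "\<bar>f a - F (g n) a\<bar> \<le> q * (q ^ n * K)"
        using tail[of a "Suc n"] by (simp add: gS mult.assoc)
      ultimately show ?thesis by linarith
    qed
    have "(\<lambda>n. 2 * (q * (q ^ n * K))) \<longlonglongrightarrow> 2 * (q * (0 * K))"
      by (intro tendsto_intros LIMSEQ_realpow_zero q)
    then have "\<bar>F f a - f a\<bar> \<le> 2 * (q * (0 * K))"
      by (rule LIMSEQ_le_const) (use le in blast)
    then show ?thesis by simp
  qed
  then have "F f = f" by (rule ext)
  moreover have "\<forall>a. \<bar>f a\<bar> \<le> K"
    using tail[of _ 0] by (simp add: g0)
  ultimately show ?thesis by blast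
qed

section \<open>Entropy and Gibbs distributions\<close>

definition shannon :: "'a::finite pmf \<Rightarrow> real" where
  "shannon p = - (\<Sum>a\<in>UNIV. pmf p a * ln (pmf p a))"

lemma abs_x_ln_x_le_1:
  fixes x :: real
  assumes "0 \<le> x" "x \<le> 1"
  shows "\<bar>x * ln x\<bar> \<le> 1"
proof (cases "x = 0")
  case False
  then have x: "0 < x" using assms by simp
  have "ln (1 / x) \<le> 1 / x - 1" using x by (intro ln_le_minus_one) simp
  then have "x * (- ln x) \<le> x * (1 / x - 1)"
    using x by (intro mult_left_mono) (auto simp: ln_div)
  also have "\<dots> \<le> 1" using x by (simp add: right_diff_distrib)
  finally have "- (x * ln x) \<le> 1" by simp
  moreover have "x * ln x \<le> 0" using x assms by (simp add: mult_le_0_iff)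
  ultimately show ?thesis by simp
qed auto

lemma abs_shannon_le: "\<bar>shannon (p :: 'a::finite pmf)\<bar> \<le> real CARD('a)"
proof -
  have "\<bar>shannon p\<bar> \<le> (\<Sum>a\<in>UNIV. \<bar>pmf p a * ln (pmf p a)\<bar>)"
    unfolding shannon_def by (simp add: sum_abs)
  also have "\<dots> \<le> (\<Sum>a\<in>(UNIV :: 'a set). 1)"
    by (intro sum_mono abs_x_ln_x_le_1) (auto simp: pmf_le_1)
  finally show ?thesis by simp
qed

definition softmax :: "('a::finite \<Rightarrow> real) \<Rightarrow> 'a \<Rightarrow> real" where
  "softmax k a = exp (k a) / (\<Sum>b\<in>UNIV. exp (k b))"

definition gibbs :: "('a::finite \<Rightarrow> real) \<Rightarrow> 'a pmf" where
  "gibbs k = embed_pmf (softmax k)"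

lemma sum_exp_pos: "0 < (\<Sum>b\<in>(UNIV::'a::finite set). exp (k b :: real))"
  by (intro sum_pos) auto

lemma pmf_gibbs: "pmf (gibbs k) a = softmax k a"
proof -
  have nn: "0 \<le> softmax k b" for b
    using sum_exp_pos[of k] by (simp add: softmax_def)
  have "(\<Sum>b\<in>UNIV. softmax k b) = 1"
    using sum_exp_pos[of k] by (simp add: softmax_def flip: sum_divide_distrib)
  then have "(\<integral>\<^sup>+ b. ennreal (softmax k b) \<partial>count_space UNIV) = 1"
    using nn by (simp add: nn_integral_count_space_finite sum_ennreal)
  then show ?thesis unfolding gibbs_def using nn by (intro pmf_embed_pmf) auto
qed

text \<open>
  The Gibbs variational principle: entropy-regularized linear payoff is maximized by the Gibbs
  distribution. With \<open>Z\<close> the normalizing constant, the payoff of \<open>p\<close> is \<open>a * ln Z\<close> minus \<open>a\<close> times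
  the relative entropy of \<open>p\<close> with respect to the Gibbs distribution, and the latter is nonnegative by
  \<open>ln x \<le> x - 1\<close>.
\<close>

lemma gibbs_variational:
  fixes p :: "'a::finite pmf"
  assumes a: "0 < a"
  shows "(\<Sum>u\<in>UNIV. pmf p u * k u) + a * shannon p
    \<le> (\<Sum>u\<in>UNIV. pmf (gibbs (\<lambda>u. k u / a)) u * k u) + a * shannon (gibbs (\<lambda>u. k u / a))"
proof -
  define Z where "Z = (\<Sum>b\<in>UNIV. exp (k b / a))"
  have Z: "0 < Z" unfolding Z_def by (rule sum_exp_pos)
  define g where "g = gibbs (\<lambda>u. k u / a)"
  have pg: "pmf g u = exp (k u / a) / Z" for u
    by (simp add: g_def pmf_gibbs softmax_def Z_def)
  have k: "k u = a * (ln (pmf g u) + ln Z)" for u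
    using a Z by (simp add: pg ln_div)
  have *: "(\<Sum>u\<in>UNIV. pmf q u * k u) + a * shannon q
      = a * ln Z + a * (\<Sum>u\<in>UNIV. pmf q u * (ln (pmf g u) - ln (pmf q u)))" for q :: "'a pmf"
  proof -
    have "(\<Sum>u\<in>UNIV. pmf q u * k u) = a * (\<Sum>u\<in>UNIV. pmf q u * ln (pmf g u)) + a * ln Z"
      unfolding k using sum_pmf_eq_1[of UNIV q]
      by (simp add: algebra_simps sum.distrib flip: sum_distrib_left sum_distrib_right)
    then show ?thesis
      by (simp add: shannon_def algebra_simps sum_subtractf)
  qed
  have "pmf p u * (ln (pmf g u) - ln (pmf p u)) \<le> pmf g u - pmf p u" for u
  proof (cases "pmf p u = 0")
    case False
    then have p: "0 < pmf p u" by (simp add: less_le)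
    have gu: "0 < pmf g u" using Z by (simp add: pg)
    have "ln (pmf g u / pmf p u) \<le> pmf g u / pmf p u - 1"
      using p gu by (intro ln_le_minus_one) simp
    then have "pmf p u * ln (pmf g u / pmf p u) \<le> pmf p u * (pmf g u / pmf p u - 1)"
      using p by (intro mult_left_mono) auto
    then show ?thesis using p gu by (simp add: ln_div algebra_simps)
  qed simp
  then have "(\<Sum>u\<in>UNIV. pmf p u * (ln (pmf g u) - ln (pmf p u))) \<le> (\<Sum>u\<in>UNIV. pmf g u - pmf p u)"
    by (intro sum_mono)
  also have "\<dots> = 0" by (simp add: sum_subtractf sum_pmf_eq_1)
  finally have "a * (\<Sum>u\<in>UNIV. pmf p u * (ln (pmf g u) - ln (pmf p u))) \<le> 0"
    using a by (simp add: mult_le_0_iff)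
  then show ?thesis unfolding g_def[symmetric] * by simp
qed

section \<open>The one-shot game\<close>

definition mixed_payoff ::
  "real \<Rightarrow> real \<Rightarrow> ('u::finite \<Rightarrow> 'w::finite \<Rightarrow> real) \<Rightarrow> 'u pmf \<Rightarrow> 'w pmf \<Rightarrow> real" where
  "mixed_payoff a b c s t =
    (\<Sum>u\<in>UNIV. \<Sum>w\<in>UNIV. pmf s u * pmf t w * c u w) + a * shannon s - b * shannon t"

text \<open>
  Exchanging the players negates the payoff, which transfers statements about the maximizer to the
  minimizer.
\<close>

lemma mixed_payoff_swap: "mixed_payoff a b c s t = - mixed_payoff b a (\<lambda>w u. - c u w) t s"
  unfolding mixed_payoff_def
  by (subst sum.swap) (simp add: sum_negf mult_ac)

lemma mixed_payoff_le_gibbs: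
  assumes "0 < a"
  shows "mixed_payoff a b c s t
    \<le> mixed_payoff a b c (gibbs (\<lambda>u. (\<Sum>w\<in>UNIV. pmf t w * c u w) / a)) t"
  using gibbs_variational[OF assms, of s "\<lambda>u. \<Sum>w\<in>UNIV. pmf t w * c u w"]
  by (simp add: mixed_payoff_def sum_distrib_left mult.assoc)

lemma gibbs_le_mixed_payoff:
  assumes "0 < b"
  shows "mixed_payoff a b c s (gibbs (\<lambda>w. (\<Sum>u\<in>UNIV. pmf s u * - c u w) / b))
    \<le> mixed_payoff a b c s t"
  using mixed_payoff_le_gibbs[OF assms, of a "\<lambda>w u. - c u w" t s]
  by (simp add: mixed_payoff_swap[of a b c])

lemma mixed_payoff_le_add:
  assumes "\<And>u w. c u w \<le> c' u w + d"
  shows "mixed_payoff a b c s t \<le> mixed_payoff a b c' s t + d"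
proof -
  have "(\<Sum>u\<in>UNIV. \<Sum>w\<in>UNIV. pmf s u * pmf t w * c u w)
      \<le> (\<Sum>u\<in>UNIV. \<Sum>w\<in>UNIV. pmf s u * pmf t w * (c' u w + d))"
    using assms by (intro sum_mono mult_left_mono) auto
  also have "\<dots> = (\<Sum>u\<in>UNIV. \<Sum>w\<in>UNIV. pmf s u * pmf t w * c' u w)
      + (\<Sum>u\<in>UNIV. pmf s u) * (\<Sum>w\<in>UNIV. pmf t w) * d"
    unfolding sum_product by (simp only: distrib_left sum.distrib sum_distrib_right)
  finally show ?thesis by (simp add: mixed_payoff_def sum_pmf_eq_1)
qed

lemma abs_mixed_payoff_le:
  fixes c :: "'u::finite \<Rightarrow> 'w::finite \<Rightarrow> real"
  assumes "0 \<le> a" "0 \<le> b" "\<And>u w. \<bar>c u w\<bar> \<le> d"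
  shows "\<bar>mixed_payoff a b c s t\<bar> \<le> d + a * real CARD('u) + b * real CARD('w)"
proof -
  have z: "mixed_payoff a b (\<lambda>_ _. 0) s t = a * shannon s - b * shannon t"
    by (simp add: mixed_payoff_def)
  have "mixed_payoff a b c s t \<le> mixed_payoff a b (\<lambda>_ _. 0) s t + d"
    using assms(3) by (intro mixed_payoff_le_add) (simp add: abs_le_iff)
  moreover have "mixed_payoff a b (\<lambda>_ _. 0) s t \<le> mixed_payoff a b c s t + d"
  proof (rule mixed_payoff_le_add)
    show "0 \<le> c u w + d" for u w using assms(3)[of u w] by linarith
  qed
  moreover have "\<bar>a * shannon s\<bar> \<le> a * real CARD('u)" "\<bar>b * shannon t\<bar> \<le> b * real CARD('w)"
    using assms(1,2) abs_shannon_le[of s] abs_shannon_le[of t]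
    by (auto simp: abs_mult intro!: mult_left_mono)
  ultimately show ?thesis using z by linarith
qed

lemma convex_prob_vecs: "convex (prob_vecs :: (real ^ 'a::finite) set)"
  unfolding convex_def prob_vecs_def
  by (auto simp: sum.distrib simp flip: sum_distrib_left)

text \<open>
  A saddle point is a pair of mutual best responses. Since the Gibbs responses are continuous, the
  composition of the two response maps has a fixed point on the simplex of player 1 by Brouwer's
  theorem, and this mixed action together with player 2's response to it is such a pair.
\<close>

lemma ex_saddle_mixed_payoff:
  fixes c :: "'u::finite \<Rightarrow> 'w::finite \<Rightarrow> real"
  assumes "0 < a" "0 < b"
  shows "\<exists>s t. saddle (mixed_payoff a b c) UNIV UNIV s t"
proof -
  define kw where "kw v w = (\<Sum>u\<in>UNIV. v $ u * - c u w) / b" for v :: "real ^ 'u" and w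
  define ku where "ku v u = (\<Sum>w\<in>UNIV. softmax (kw v) w * c u w) / a" for v u
  (* kw and ku are the exponents whose Gibbs distributions are player 2's response to v and
     player 1's response to that response *)
  define F where "F v = pmf_vec (gibbs (ku v))" for v
  have ne: "(\<Sum>b\<in>UNIV. exp (k b :: real)) \<noteq> 0" for k :: "'d::finite \<Rightarrow> real"
    using sum_exp_pos[of k] by simp
  have cont: "continuous_on prob_vecs F"
    unfolding F_def pmf_vec_def pmf_gibbs softmax_def ku_def kw_def
    using assms by (intro continuous_intros ballI ne) auto
  have "F \<in> prob_vecs \<rightarrow> prob_vecs"
    using range_pmf_vec[where 'a = 'u] by (auto simp: F_def)
  then obtain v where v: "v \<in> prob_vecs" "F v = v"
    using brouwer[OF compact_prob_vecs convex_prob_vecs _ cont] range_pmf_vec[where 'a = 'u] by blast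
  define s t where "s = gibbs (ku v)" and "t = gibbs (kw v)"
  have vs: "v $ u = pmf s u" for u
    using v(2) by (auto simp: F_def pmf_vec_def s_def vec_eq_iff)
  have "s = gibbs (\<lambda>u. (\<Sum>w\<in>UNIV. pmf t w * c u w) / a)"
    by (simp add: s_def t_def ku_def[abs_def] pmf_gibbs)
  moreover have "t = gibbs (\<lambda>w. (\<Sum>u\<in>UNIV. pmf s u * - c u w) / b)"
    unfolding t_def kw_def[abs_def] vs ..
  ultimately have "saddle (mixed_payoff a b c) UNIV UNIV s t"
    using mixed_payoff_le_gibbs[OF assms(1), of b c _ t] gibbs_le_mixed_payoff[OF assms(2), of a c s]
    by (auto simp: saddle_def)
  then show ?thesis by blast
qed

section \<open>Expectations and entropies of finitely supported laws\<close>

lemma expectation_bind_finite: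
  fixes f :: "'b \<Rightarrow> real"
  assumes "finite (set_pmf p)" "\<And>x. finite (set_pmf (k x))"
  shows "measure_pmf.expectation (bind_pmf p k) f =
    measure_pmf.expectation p (\<lambda>x. measure_pmf.expectation (k x) f)"
proof -
  have "measure_pmf.expectation (bind_pmf p k) f =
      (\<Sum>a\<in>set_pmf p. pmf p a *\<^sub>R measure_pmf.expectation (k a) f)"
    using assms by (intro pmf_expectation_bind) auto
  also have "\<dots> = measure_pmf.expectation p (\<lambda>x. measure_pmf.expectation (k x) f)"
    using assms by (subst integral_measure_pmf_real[of "set_pmf p"]) (auto simp: mult.commute)
  finally show ?thesis .
qed

lemma expectation_finite:
  fixes f :: "'a::finite \<Rightarrow> real"
  shows "measure_pmf.expectation p f = (\<Sum>a\<in>UNIV. pmf p a * f a)"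
  by (subst integral_measure_pmf_real[of UNIV]) (auto simp: mult.commute)

lemma abs_expectation_le:
  fixes f :: "'a \<Rightarrow> real"
  assumes "finite (set_pmf p)" "\<And>x. \<bar>f x\<bar> \<le> B"
  shows "\<bar>measure_pmf.expectation p f\<bar> \<le> B"
proof -
  have "integrable (measure_pmf p) f"
    by (rule integrable_measure_pmf_finite) fact
  then have "measure_pmf.expectation p f \<le> B" "- B \<le> measure_pmf.expectation p f"
    using assms(2) by (auto simp: abs_le_iff minus_le_iff
      intro!: measure_pmf.integral_le_const measure_pmf.integral_ge_const)
  then show ?thesis by simp
qed

lemma expectation_mono_finite:
  fixes f :: "'a \<Rightarrow> real"
  assumes "finite (set_pmf p)" "\<And>x. f x \<le> g x"
  shows "measure_pmf.expectation p f \<le> measure_pmf.expectation p g"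
  by (intro integral_mono integrable_measure_pmf_finite) (use assms in auto)

text \<open>
  If \<open>X\<close> is drawn from the kernel \<open>k\<close> at \<open>Y\<close>, then the ratio of joint to marginal probability in the
  conditional entropy is the kernel itself, so that the conditional entropy is the mean entropy of
  the kernel. For the action drawn at a history, the kernel is the player's strategy.
\<close>

lemma cond_entropy_kernel:
  fixes X :: "'a \<Rightarrow> 'b::finite" and Y :: "'a \<Rightarrow> 'c::countable"
  assumes fin: "finite (set_pmf p)"
    and joint: "map_pmf (\<lambda>a. (X a, Y a)) p = bind_pmf \<mu> (\<lambda>y. map_pmf (\<lambda>x. (x, y)) (k y))"
  shows "cond_entropy p X Y = measure_pmf.expectation \<mu> (\<lambda>y. shannon (k y))"
proof -
  define q where "q = map_pmf (\<lambda>a. (X a, Y a)) p"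
  have "pmf (map_pmf (\<lambda>x. (x, y)) (k y)) (x, y) = pmf (k y) x" for x y
    by (rule pmf_map_inj') (auto simp: inj_def)
  then have pq: "pmf q (x, y) = pmf (k y) x * pmf \<mu> y" for x y
    unfolding q_def joint
    by (subst pmf_bind_single[where a = y]) (auto simp: pmf_eq_0_set_pmf)
  have marg: "map_pmf Y p = \<mu>"
  proof -
    have "map_pmf Y p = map_pmf snd q" by (simp add: q_def pmf.map_comp o_def)
    also have "\<dots> = \<mu>"
      by (simp add: q_def joint map_bind_pmf pmf.map_comp o_def map_pmf_const bind_return_pmf')
    finally show ?thesis .
  qed
  have fin\<mu>: "finite (set_pmf \<mu>)" using fin by (simp flip: marg)
  define f where "f z = pmf q z * ln (pmf q z / pmf \<mu> (snd z))" for z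
  have sub: "set_pmf q \<subseteq> UNIV \<times> set_pmf \<mu>"
    by (auto simp: q_def joint)
  have "cond_entropy p X Y = - (\<Sum>z\<in>set_pmf q. f z)"
    unfolding cond_entropy_eq_sum[OF fin] f_def marg q_def by simp
  also have "(\<Sum>z\<in>set_pmf q. f z) = (\<Sum>z\<in>UNIV \<times> set_pmf \<mu>. f z)"
    using sub fin\<mu> by (intro sum.mono_neutral_left) (auto simp: f_def pmf_eq_0_set_pmf)
  also have "\<dots> = (\<Sum>x\<in>UNIV. \<Sum>y\<in>set_pmf \<mu>. f (x, y))"
    by (simp add: sum.cartesian_product)
  also have "\<dots> = (\<Sum>y\<in>set_pmf \<mu>. \<Sum>x\<in>UNIV. f (x, y))"
    by (rule sum.swap)
  also have "\<dots> = (\<Sum>y\<in>set_pmf \<mu>. - (shannon (k y) * pmf \<mu> y))"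
    by (intro sum.cong refl)
      (auto simp: f_def pq shannon_def pmf_eq_0_set_pmf sum_distrib_left mult_ac)
  finally show ?thesis
    using fin\<mu> by (subst integral_measure_pmf_real[of "set_pmf \<mu>"]) (auto simp: sum_negf)
qed

lemma finite_set_act:
  fixes \<sigma> :: "('x, 'u::finite, 'w::finite, 'u) strategy"
  assumes "finite (set_pmf \<mu>)"
  shows "finite (set_pmf (act \<sigma> \<tau> \<mu>))"
  using assms by (simp add: act_def)

lemma finite_set_history_law:
  fixes P :: "'x::finite \<Rightarrow> 'u::finite \<Rightarrow> 'w::finite \<Rightarrow> 'x pmf"
  shows "finite (set_pmf (history_law P \<mu>1 \<sigma> \<tau> t))"
  by (induction t) (auto simp: finite_set_act split: prod.split)

lemma expectation_act:
  fixes \<sigma> :: "('x, 'u::finite, 'w::finite, 'u) strategy" and f :: "_ \<Rightarrow> real"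
  assumes "finite (set_pmf \<mu>)"
  shows "measure_pmf.expectation (act \<sigma> \<tau> \<mu>) f = measure_pmf.expectation \<mu>
    (\<lambda>h. \<Sum>u\<in>UNIV. \<Sum>w\<in>UNIV. pmf (\<sigma> h) u * pmf (\<tau> h) w * f (h, u, w))"
  using assms
  by (simp add: act_def expectation_bind_finite expectation_finite sum_distrib_left mult.assoc)

lemma cond_entropy_act:
  fixes \<sigma> :: "('x::finite, 'u::finite, 'w::finite, 'u) strategy"
  assumes "finite (set_pmf \<mu>)"
  shows "cond_entropy (act \<sigma> \<tau> \<mu>) (\<lambda>(h, u, w). u) (\<lambda>(h, u, w). h)
      = measure_pmf.expectation \<mu> (\<lambda>h. shannon (\<sigma> h))"
    and "cond_entropy (act \<sigma> \<tau> \<mu>) (\<lambda>(h, u, w). w) (\<lambda>(h, u, w). h)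
      = measure_pmf.expectation \<mu> (\<lambda>h. shannon (\<tau> h))"
  by (intro cond_entropy_kernel finite_set_act assms;
      simp add: act_def map_bind_pmf map_pmf_def bind_assoc_pmf bind_return_pmf)+

section \<open>Discounted sums\<close>

text \<open>
  Iterating the one-step inequality \<open>n\<close> times leaves the remainder \<open>q ^ n * e n\<close>, which vanishes in
  the limit because \<open>e\<close> is bounded. In the application \<open>e t\<close> is the expected value of \<open>W\<close> and \<open>p t\<close>
  the expected payoff at time \<open>t\<close>.
\<close>

lemma le_discounted_sum:
  fixes e p :: "nat \<Rightarrow> real"
  assumes q: "0 \<le> q" "q < 1"
    and e: "\<And>t. \<bar>e t\<bar> \<le> B" and p: "\<And>t. \<bar>p t\<bar> \<le> M"
    and step: "\<And>t. e t \<le> p t + q * e (Suc t)"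
  shows "e 0 \<le> (\<Sum>t. q ^ t * p t)"
proof -
  have sm: "summable (\<lambda>t. q ^ t * M)" using q by (simp add: summable_mult2)
  have s: "summable (\<lambda>t. q ^ t * p t)"
    by (rule summable_comparison_test'[OF sm])
      (use p q in \<open>auto simp: abs_mult intro!: mult_left_mono\<close>)
  have le: "e 0 \<le> (\<Sum>t<n. q ^ t * p t) + q ^ n * B" for n
  proof -
    have "e 0 \<le> (\<Sum>t<n. q ^ t * p t) + q ^ n * e n"
    proof (induction n)
      case (Suc n)
      have "q ^ n * e n \<le> q ^ n * (p n + q * e (Suc n))"
        using q step by (intro mult_left_mono) auto
      then show ?case using Suc by (simp add: algebra_simps)
    qed simp
    moreover have "q ^ n * e n \<le> q ^ n * B"
      using q e by (intro mult_left_mono) (auto simp: abs_le_iff)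
    ultimately show ?thesis by linarith
  qed
  have "(\<lambda>n. (\<Sum>t<n. q ^ t * p t) + q ^ n * B) \<longlonglongrightarrow> (\<Sum>t. q ^ t * p t) + 0 * B"
    by (intro tendsto_intros summable_LIMSEQ s LIMSEQ_realpow_zero q)
  then have "e 0 \<le> (\<Sum>t. q ^ t * p t) + 0 * B"
    by (rule LIMSEQ_le_const) (use le in blast)
  then show ?thesis by simp
qed

lemma discounted_sum_le:
  fixes e p :: "nat \<Rightarrow> real"
  assumes q: "0 \<le> q" "q < 1"
    and e: "\<And>t. \<bar>e t\<bar> \<le> B" and p: "\<And>t. \<bar>p t\<bar> \<le> M"
    and step: "\<And>t. p t + q * e (Suc t) \<le> e t"
  shows "(\<Sum>t. q ^ t * p t) \<le> e 0"
proof -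
  have "- e 0 \<le> (\<Sum>t. q ^ t * - p t)"
    by (rule le_discounted_sum[of q "\<lambda>t. - e t" B "\<lambda>t. - p t" M])
      (use assms in \<open>auto simp: algebra_simps\<close>)
  moreover have "summable (\<lambda>t. q ^ t * p t)"
    by (rule summable_comparison_test'[of "\<lambda>t. q ^ t * M"])
      (use p q in \<open>auto simp: abs_mult summable_mult2 intro!: mult_left_mono\<close>)
  ultimately show ?thesis by (simp add: suminf_minus)
qed

section \<open>The dynamic game\<close>

lemma stationary_iff: "s \<in> stationary \<longleftrightarrow> (\<forall>g x. s (g, x) = s ([], x))"
proof
  show "\<forall>g x. s (g, x) = s ([], x)" if "s \<in> stationary"
    using that by (auto simp: stationary_def)
  show "s \<in> stationary" if "\<forall>g x. s (g, x) = s ([], x)"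
    unfolding stationary_def using that by (intro CollectI exI[of _ "\<lambda>x. s ([], x)"]) blast
qed

locale entropy_game =
  fixes P :: "'x::finite \<Rightarrow> 'u::finite \<Rightarrow> 'w::finite \<Rightarrow> 'x pmf"
    and R :: "'x \<Rightarrow> 'u \<Rightarrow> 'w \<Rightarrow> real"
    and \<gamma> \<beta>1 \<beta>2 :: real
  assumes \<gamma>: "0 < \<gamma>" "\<gamma> < 1" and \<beta>: "0 < \<beta>1" "0 < \<beta>2"
begin

abbreviation one_shot :: "('u \<Rightarrow> 'w \<Rightarrow> real) \<Rightarrow> 'u pmf \<Rightarrow> 'w pmf \<Rightarrow> real" where
  "one_shot \<equiv> mixed_payoff (1 / \<beta>1) (1 / \<beta>2)"

abbreviation payoff ::
  "'x pmf \<Rightarrow> ('x, 'u, 'w, 'u) strategy \<Rightarrow> ('x, 'u, 'w, 'w) strategy \<Rightarrow> real" where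
  "payoff \<equiv> discounted_payoff P R \<gamma> \<beta>1 \<beta>2"

text \<open>
  Continuation values are functions of the whole history, since a best reply to a history-dependent
  strategy must take the past into account.
\<close>

definition cont_payoff :: "(('x, 'u, 'w) history \<Rightarrow> real) \<Rightarrow> ('x, 'u, 'w) history \<Rightarrow> 'u \<Rightarrow> 'w \<Rightarrow> real" where
  "cont_payoff W h u w = R (snd h) u w
    + \<gamma> * (\<Sum>x'\<in>UNIV. pmf (P (snd h) u w) x' * W (fst h @ [(snd h, u, w)], x'))"

text \<open>
  For a continuation value that depends on the current state only, the one-shot game is the one in
  the Shapley operator, whatever the past \<open>g\<close>.
\<close>

lemma local_payoff_eq_one_shot:
  "local_payoff P R \<gamma> \<beta>1 \<beta>2 V x = one_shot (cont_payoff (\<lambda>h. V (snd h)) (g, x))"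
proof (intro ext)
  fix s t
  define c where "c u w = R x u w + \<gamma> * (\<Sum>x'\<in>UNIV. pmf (P x u w) x' * V x')" for u w
  have "local_payoff P R \<gamma> \<beta>1 \<beta>2 V x s t = (\<Sum>u\<in>UNIV. \<Sum>w\<in>UNIV. pmf s u * pmf t w * c u w
      - (1 / \<beta>1 * (pmf s u * ln (pmf s u))) * pmf t w
      + pmf s u * (1 / \<beta>2 * (pmf t w * ln (pmf t w))))"
    unfolding local_payoff_def
    by (subst integral_measure_pmf_real[where A = "UNIV \<times> UNIV"])
      (auto simp: pmf_pair c_def sum.cartesian_product algebra_simps
        simp del: UNIV_Times_UNIV intro!: sum.cong)
  also have "\<dots> = (\<Sum>u\<in>UNIV. \<Sum>w\<in>UNIV. pmf s u * pmf t w * c u w)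
      - (\<Sum>u\<in>UNIV. 1 / \<beta>1 * (pmf s u * ln (pmf s u))) * (\<Sum>w\<in>UNIV. pmf t w)
      + (\<Sum>u\<in>UNIV. pmf s u) * (\<Sum>w\<in>UNIV. 1 / \<beta>2 * (pmf t w * ln (pmf t w)))"
    unfolding sum_product by (simp only: sum.distrib sum_subtractf)
  also have "\<dots> = one_shot c s t"
    by (simp add: mixed_payoff_def shannon_def sum_pmf_eq_1 flip: sum_distrib_left sum_divide_distrib)
  finally show "local_payoff P R \<gamma> \<beta>1 \<beta>2 V x s t = one_shot (cont_payoff (\<lambda>h. V (snd h)) (g, x)) s t"
    by (simp add: c_def[abs_def] cont_payoff_def[abs_def])
qed

lemma ex_one_shot_best_response2: "\<exists>t. \<forall>t'. one_shot c s t \<le> one_shot c s t'"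
  using gibbs_le_mixed_payoff[of "1 / \<beta>2" "1 / \<beta>1" c s] \<beta>(2)
  by (meson divide_pos_pos zero_less_one)

lemma ex_one_shot_best_response1: "\<exists>s. \<forall>s'. one_shot c s' t \<le> one_shot c s t"
  using mixed_payoff_le_gibbs[of "1 / \<beta>1" "1 / \<beta>2" c _ t] \<beta>(1)
  by (meson divide_pos_pos zero_less_one)

lemma cont_payoff_le:
  assumes "\<And>h. W h \<le> W' h + d"
  shows "cont_payoff W h u w \<le> cont_payoff W' h u w + \<gamma> * d"
proof -
  have "(\<Sum>x'\<in>UNIV. pmf (P (snd h) u w) x' * W (fst h @ [(snd h, u, w)], x'))
      \<le> (\<Sum>x'\<in>UNIV. pmf (P (snd h) u w) x' * (W' (fst h @ [(snd h, u, w)], x') + d))"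
    using assms by (intro sum_mono mult_left_mono) auto
  also have "\<dots> = (\<Sum>x'\<in>UNIV. pmf (P (snd h) u w) x' * W' (fst h @ [(snd h, u, w)], x')) + d"
    by (simp add: distrib_left sum.distrib sum_pmf_eq_1 flip: sum_distrib_right)
  finally show ?thesis
    using \<gamma> by (simp add: cont_payoff_def flip: distrib_left)
qed

lemma ex_reward_bound: "\<exists>M. \<forall>x u w. \<bar>R x u w\<bar> \<le> M"
  by (intro exI[of _ "Max (range (\<lambda>(x, u, w). \<bar>R x u w\<bar>))"] allI Max_ge)
    (auto intro: image_eqI[of _ _ "(_, _, _)"])

lemma ex_one_shot_zero_bound: "\<exists>M. \<forall>h s t. \<bar>one_shot (cont_payoff (\<lambda>_. 0) h) s t\<bar> \<le> M"
proof -
  obtain M where M: "\<And>x u w. \<bar>R x u w\<bar> \<le> M" using ex_reward_bound by blast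
  have "\<bar>one_shot (cont_payoff (\<lambda>_. 0) h) s t\<bar> \<le> M + 1 / \<beta>1 * real CARD('u) + 1 / \<beta>2 * real CARD('w)"
    for h s t
    using \<beta> M by (intro abs_mixed_payoff_le) (auto simp: cont_payoff_def)
  then show ?thesis by blast
qed

text \<open>
  The one-step identity on which the verification argument rests. Every term is an expectation over
  the law of the history at time \<open>t\<close>: the actions are drawn from the strategies given the history,
  so the conditional entropies become mean entropies of the mixed actions, and the next history is
  drawn from the transition kernel given the current history and actions.
\<close>

lemma stage_payoff_plus_continuation:
  "stage_payoff P R \<beta>1 \<beta>2 \<mu>1 \<sigma> \<tau> t
      + \<gamma> * measure_pmf.expectation (history_law P \<mu>1 \<sigma> \<tau> (Suc t)) W
    = measure_pmf.expectation (history_law P \<mu>1 \<sigma> \<tau> t) (\<lambda>h. one_shot (cont_payoff W h) (\<sigma> h) (\<tau> h))"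
proof -
  define \<mu> where "\<mu> = history_law P \<mu>1 \<sigma> \<tau> t"
  have fin: "finite (set_pmf \<mu>)" unfolding \<mu>_def by (rule finite_set_history_law)
  have E: "measure_pmf.expectation \<mu> f = (\<Sum>h\<in>set_pmf \<mu>. f h * pmf \<mu> h)"
    for f :: "_ \<Rightarrow> real"
    using fin by (intro integral_measure_pmf_real) auto
  (* N is the expected continuation value given history and actions *)
  define N where "N = (\<lambda>((h, x), u, w).
    \<Sum>x'\<in>UNIV. pmf (P x u w) x' * W (h @ [(x, u, w)], x'))"
  have "measure_pmf.expectation (history_law P \<mu>1 \<sigma> \<tau> (Suc t)) W
      = measure_pmf.expectation (act \<sigma> \<tau> \<mu>) N"
    unfolding history_law.simps \<mu>_def[symmetric]
    by (subst expectation_bind_finite)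
      (auto simp: fin finite_set_act N_def expectation_finite split: prod.split
        intro!: Bochner_Integration.integral_cong)
  also have "\<dots> = measure_pmf.expectation \<mu>
      (\<lambda>h. \<Sum>u\<in>UNIV. \<Sum>w\<in>UNIV. pmf (\<sigma> h) u * pmf (\<tau> h) w * N (h, u, w))"
    by (rule expectation_act[OF fin])
  finally have next_stage: "measure_pmf.expectation (history_law P \<mu>1 \<sigma> \<tau> (Suc t)) W = \<dots>" .
  have cp: "cont_payoff W h u w = R (snd h) u w + \<gamma> * N (h, u, w)" for h u w
    by (simp add: cont_payoff_def N_def split_beta)
  have mixed: "one_shot (cont_payoff W h) (\<sigma> h) (\<tau> h)
      = (\<Sum>u\<in>UNIV. \<Sum>w\<in>UNIV. pmf (\<sigma> h) u * pmf (\<tau> h) w * R (snd h) u w)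
        + 1 / \<beta>1 * shannon (\<sigma> h) - 1 / \<beta>2 * shannon (\<tau> h)
        + \<gamma> * (\<Sum>u\<in>UNIV. \<Sum>w\<in>UNIV. pmf (\<sigma> h) u * pmf (\<tau> h) w * N (h, u, w))" for h
    by (simp add: mixed_payoff_def cp distrib_left sum.distrib sum_distrib_left mult_ac)
  have "(\<lambda>((h, x), u, w). R x u w) = (\<lambda>(h :: ('x, 'u, 'w) history, u, w). R (snd h) u w)"
    by auto
  then have "stage_payoff P R \<beta>1 \<beta>2 \<mu>1 \<sigma> \<tau> t = measure_pmf.expectation \<mu>
        (\<lambda>h. \<Sum>u\<in>UNIV. \<Sum>w\<in>UNIV. pmf (\<sigma> h) u * pmf (\<tau> h) w * R (snd h) u w)
      + 1 / \<beta>1 * measure_pmf.expectation \<mu> (\<lambda>h. shannon (\<sigma> h))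
      - 1 / \<beta>2 * measure_pmf.expectation \<mu> (\<lambda>h. shannon (\<tau> h))"
    unfolding stage_payoff_def stage_law_def \<mu>_def[symmetric] Let_def
    by (simp add: expectation_act[OF fin] cond_entropy_act[OF fin])
  then show ?thesis
    unfolding next_stage mixed \<mu>_def[symmetric] E
    by (simp add: sum_distrib_left[of _ _ "set_pmf \<mu>"] distrib_right left_diff_distrib sum.distrib
        sum_subtractf mult.assoc)
qed

lemma ex_stage_payoff_bound: "\<exists>M. \<forall>t. \<bar>stage_payoff P R \<beta>1 \<beta>2 \<mu>1 \<sigma> \<tau> t\<bar> \<le> M"
proof -
  obtain M where M: "\<And>h s t. \<bar>one_shot (cont_payoff (\<lambda>_. 0) h) s t\<bar> \<le> M"
    using ex_one_shot_zero_bound by blast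
  have "\<bar>stage_payoff P R \<beta>1 \<beta>2 \<mu>1 \<sigma> \<tau> t\<bar> \<le> M" for t
    using abs_expectation_le[OF finite_set_history_law M, of P \<mu>1 \<sigma> \<tau> t "\<lambda>h. h" \<sigma> \<tau>]
      stage_payoff_plus_continuation[of \<mu>1 \<sigma> \<tau> t "\<lambda>_. 0"] by simp
  then show ?thesis by blast
qed

lemma expectation_initial:
  "measure_pmf.expectation (history_law P \<mu>1 \<sigma> \<tau> 0) W = (\<Sum>x\<in>UNIV. pmf \<mu>1 x * W ([], x))"
  by (simp add: expectation_finite)

lemma payoff_ge:
  assumes "\<And>h. \<bar>W h\<bar> \<le> B" "\<And>h. W h \<le> one_shot (cont_payoff W h) (\<sigma> h) (\<tau> h)"
  shows "(\<Sum>x\<in>UNIV. pmf \<mu>1 x * W ([], x)) \<le> payoff \<mu>1 \<sigma> \<tau>"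
proof -
  obtain M where "\<And>t. \<bar>stage_payoff P R \<beta>1 \<beta>2 \<mu>1 \<sigma> \<tau> t\<bar> \<le> M"
    using ex_stage_payoff_bound by blast
  then show ?thesis
    unfolding expectation_initial[of \<mu>1 \<sigma> \<tau>, symmetric] discounted_payoff_def
    using \<gamma> assms
    by (intro le_discounted_sum[where e = "\<lambda>t. measure_pmf.expectation (history_law P \<mu>1 \<sigma> \<tau> t) W"])
      (auto simp: stage_payoff_plus_continuation simp del: history_law.simps
        intro!: abs_expectation_le expectation_mono_finite finite_set_history_law)
qed

lemma payoff_le:
  assumes "\<And>h. \<bar>W h\<bar> \<le> B" "\<And>h. one_shot (cont_payoff W h) (\<sigma> h) (\<tau> h) \<le> W h"
  shows "payoff \<mu>1 \<sigma> \<tau> \<le> (\<Sum>x\<in>UNIV. pmf \<mu>1 x * W ([], x))"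
proof -
  obtain M where "\<And>t. \<bar>stage_payoff P R \<beta>1 \<beta>2 \<mu>1 \<sigma> \<tau> t\<bar> \<le> M"
    using ex_stage_payoff_bound by blast
  then show ?thesis
    unfolding expectation_initial[of \<mu>1 \<sigma> \<tau>, symmetric] discounted_payoff_def
    using \<gamma> assms
    by (intro discounted_sum_le[where e = "\<lambda>t. measure_pmf.expectation (history_law P \<mu>1 \<sigma> \<tau> t) W"])
      (auto simp: stage_payoff_plus_continuation simp del: history_law.simps
        intro!: abs_expectation_le expectation_mono_finite finite_set_history_law)
qed

text \<open>
  From one-shot saddle points to a saddle point of the dynamic game. The action sets may vary with the
  history, so that fixing a player's strategy is the special case of singletons.
\<close>

theorem ex_dynamic_saddle:
  fixes S :: "('x, 'u, 'w) history \<Rightarrow> 'u pmf set" and T :: "('x, 'u, 'w) history \<Rightarrow> 'w pmf set"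
  assumes sdl: "\<And>h c. \<exists>s t. saddle (one_shot c) (S h) (T h) s t"
  obtains W \<sigma> \<tau> where
    "\<And>h. saddle (one_shot (cont_payoff W h)) (S h) (T h) (\<sigma> h) (\<tau> h)"
    "\<And>h. one_shot (cont_payoff W h) (\<sigma> h) (\<tau> h) = W h"
    "\<And>\<mu>1. saddle (payoff \<mu>1) {\<sigma>. \<forall>h. \<sigma> h \<in> S h} {\<tau>. \<forall>h. \<tau> h \<in> T h} \<sigma> \<tau>"
    "\<And>\<mu>1. payoff \<mu>1 \<sigma> \<tau> = (\<Sum>x\<in>UNIV. pmf \<mu>1 x * W ([], x))"
    "(\<And>g x. S (g, x) = S ([], x)) \<Longrightarrow> (\<And>g x. T (g, x) = T ([], x)) \<Longrightarrow>
      (\<forall>g x. W (g, x) = W ([], x)) \<and> \<sigma> \<in> stationary \<and> \<tau> \<in> stationary"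
proof -
  (* The chosen saddle point is a function of the two action sets and the one-shot payoff alone, not of the
     history itself; otherwise the resulting strategies could fail to be stationary. *)
  obtain s t where st: "\<And>h c. saddle (one_shot c) (S h) (T h) (s (S h) (T h) c) (t (S h) (T h) c)"
  proof -
    define p where "p A B c = (SOME z. saddle (one_shot c) A B (fst z) (snd z))" for A B c
    have "saddle (one_shot c) (S h) (T h) (fst (p (S h) (T h) c)) (snd (p (S h) (T h) c))" for h c
      unfolding p_def by (rule someI_ex) (use sdl[of c h] in auto)
    then show thesis by (intro that[of "\<lambda>A B c. fst (p A B c)" "\<lambda>A B c. snd (p A B c)"])
  qed
  define F where
    "F W h = one_shot (cont_payoff W h) (s (S h) (T h) (cont_payoff W h)) (t (S h) (T h) (cont_payoff W h))" for W h
  have le: "F W h \<le> F W' h + \<gamma> * d" if "\<And>h. W h \<le> W' h + d" for W W' h d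
    unfolding F_def
    by (rule saddle_value_le[OF st st]) (intro mixed_payoff_le_add cont_payoff_le that)
  have contr: "\<bar>F W h - F W' h\<bar> \<le> \<gamma> * d" if *: "\<And>h. \<bar>W h - W' h\<bar> \<le> d" for W W' h d
  proof -
    have "W h \<le> W' h + d" "W' h \<le> W h + d" for h
      using *[of h] by linarith+
    then have "F W h \<le> F W' h + \<gamma> * d" "F W' h \<le> F W h + \<gamma> * d"
      by (auto intro: le)
    then show ?thesis by linarith
  qed
  obtain M where "\<And>h. \<bar>F (\<lambda>_. 0) h\<bar> \<le> M"
    using ex_one_shot_zero_bound unfolding F_def by blast
  then obtain W B where W: "F W = W" "\<And>h. \<bar>W h\<bar> \<le> B"
    using sup_contraction_fixpoint[of \<gamma> F M] \<gamma> contr by (metis less_imp_le)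
  define \<sigma> where "\<sigma> h = s (S h) (T h) (cont_payoff W h)" for h
  define \<tau> where "\<tau> h = t (S h) (T h) (cont_payoff W h)" for h
  have sd: "saddle (one_shot (cont_payoff W h)) (S h) (T h) (\<sigma> h) (\<tau> h)" for h
    unfolding \<sigma>_def \<tau>_def by (rule st)
  have val: "one_shot (cont_payoff W h) (\<sigma> h) (\<tau> h) = W h" for h
    using fun_cong[OF W(1), of h] by (simp add: F_def \<sigma>_def \<tau>_def)
  have pay: "payoff \<mu>1 \<sigma> \<tau> = (\<Sum>x\<in>UNIV. pmf \<mu>1 x * W ([], x))" for \<mu>1
    by (intro antisym payoff_ge[OF W(2)] payoff_le[OF W(2)]) (simp_all add: val)
  have "saddle (payoff \<mu>1) {\<sigma>. \<forall>h. \<sigma> h \<in> S h} {\<tau>. \<forall>h. \<tau> h \<in> T h} \<sigma> \<tau>" for \<mu>1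
    unfolding saddle_def pay
  proof (intro conjI ballI)
    show "\<sigma> \<in> {\<sigma>. \<forall>h. \<sigma> h \<in> S h}" "\<tau> \<in> {\<tau>. \<forall>h. \<tau> h \<in> T h}"
      using sd by (auto simp: saddle_def)
  next
    fix \<sigma>' assume "\<sigma>' \<in> {\<sigma>. \<forall>h. \<sigma> h \<in> S h}"
    then have "one_shot (cont_payoff W h) (\<sigma>' h) (\<tau> h) \<le> W h" for h
      using sd[of h] val[of h] by (simp add: saddle_def del: split_paired_All)
    then show "payoff \<mu>1 \<sigma>' \<tau> \<le> (\<Sum>x\<in>UNIV. pmf \<mu>1 x * W ([], x))"
      by (rule payoff_le[OF W(2)])
  next
    fix \<tau>' assume "\<tau>' \<in> {\<tau>. \<forall>h. \<tau> h \<in> T h}"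
    then have "W h \<le> one_shot (cont_payoff W h) (\<sigma> h) (\<tau>' h)" for h
      using sd[of h] val[of h] by (simp add: saddle_def del: split_paired_All)
    then show "(\<Sum>x\<in>UNIV. pmf \<mu>1 x * W ([], x)) \<le> payoff \<mu>1 \<sigma> \<tau>'"
      by (rule payoff_ge[OF W(2)])
  qed
  moreover have "(\<forall>g x. W (g, x) = W ([], x)) \<and> \<sigma> \<in> stationary \<and> \<tau> \<in> stationary"
    if ST: "\<And>g x. S (g, x) = S ([], x)" "\<And>g x. T (g, x) = T ([], x)"
  proof -
    (* the game after the past g is the original game, so W read after g solves the same equation *)
    define shift where "shift g h = W (g @ fst h, snd h)" for g h
    have cont_shift: "cont_payoff (shift g) (g', x) = cont_payoff W (g @ g', x)" for g g' x
      by (simp add: cont_payoff_def shift_def fun_eq_iff)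
    have "F (shift g) (g', x) = F W (g @ g', x)" for g g' x
      unfolding F_def cont_shift by (simp add: ST[of g'] ST[of "g @ g'"])
    then have shift_fix: "F (shift g) = shift g" for g
      using W(1) by (auto simp: shift_def fun_eq_iff)
    have "shift g = W" for g
    proof (rule sup_contraction_unique[where q = \<gamma> and F = F and B = B and C = B])
      show "\<bar>F f h - F f' h\<bar> \<le> \<gamma> * d" if "\<And>h. \<bar>f h - f' h\<bar> \<le> d" for f f' d h
        by (rule contr) (rule that)
      show "\<bar>shift g h\<bar> \<le> B" for h
        unfolding shift_def by (rule W(2))
    qed (use \<gamma> in simp, rule \<gamma>, rule shift_fix, rule W(1), rule W(2))
    then have Wst: "W (g, x) = W ([], x)" for g x
      by (metis append_Nil2 fst_conv shift_def snd_conv)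
    have cont_state: "cont_payoff W (g, x) = cont_payoff W ([], x)" for g x
      by (auto simp: cont_payoff_def fun_eq_iff Wst[of "_ @ _"] Wst[of "_ # _"])
    have "\<sigma> (g, x) = \<sigma> ([], x)" "\<tau> (g, x) = \<tau> ([], x)" for g x
      by (simp_all only: \<sigma>_def \<tau>_def ST[of g] cont_state[of g])
    then show ?thesis unfolding stationary_iff using Wst by blast
  qed
  ultimately show thesis using that[of W \<sigma> \<tau>] sd val pay by blast
qed

text \<open>
  Optimal replies to an arbitrary strategy exist, by \<open>ex_dynamic_saddle\<close> with the opponent's action
  sets reduced to singletons. Stationarity of the reply is needed for the minima over stationary
  strategies.
\<close>

lemma ex_best_response2:
  "\<exists>\<tau>. (\<forall>\<tau>'. payoff \<mu>1 \<sigma> \<tau> \<le> payoff \<mu>1 \<sigma> \<tau>') \<and> (\<sigma> \<in> stationary \<longrightarrow> \<tau> \<in> stationary)"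
proof -
  have "\<exists>s t. saddle (one_shot c) {\<sigma> h} UNIV s t" for h c
    using ex_one_shot_best_response2 by (auto simp: saddle_def)
  then obtain \<sigma>' \<tau> where *: "saddle (payoff \<mu>1) {\<sigma>'. \<forall>h. \<sigma>' h \<in> {\<sigma> h}} {\<tau>. \<forall>h. \<tau> h \<in> UNIV} \<sigma>' \<tau>"
    "(\<And>g x. {\<sigma> (g, x)} = {\<sigma> ([], x)}) \<Longrightarrow> \<tau> \<in> stationary"
    by (rule ex_dynamic_saddle[of "\<lambda>h. {\<sigma> h}" "\<lambda>_. UNIV"]) blast+
  (* the action sets of player 1 are singletons, so the saddle point reply of player 2 is a best
     reply to the given strategy *)
  have "\<sigma>' = \<sigma>" using *(1) by (auto simp: saddle_def)
  then show ?thesis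
    using * by (intro exI[of _ \<tau>]) (auto simp: saddle_def stationary_def)
qed

lemma ex_best_response1:
  "\<exists>\<sigma>. \<forall>\<sigma>'. payoff \<mu>1 \<sigma>' \<tau> \<le> payoff \<mu>1 \<sigma> \<tau>"
proof -
  have "\<exists>s t. saddle (one_shot c) UNIV {\<tau> h} s t" for h c
    using ex_one_shot_best_response1 by (auto simp: saddle_def)
  then obtain \<sigma> \<tau>' where *: "saddle (payoff \<mu>1) {\<sigma>. \<forall>h. \<sigma> h \<in> UNIV} {\<tau>'. \<forall>h. \<tau>' h \<in> {\<tau> h}} \<sigma> \<tau>'"
    by (rule ex_dynamic_saddle[of "\<lambda>_. UNIV" "\<lambda>h. {\<tau> h}"]) blast+
  have "\<tau>' = \<tau>" using * by (auto simp: saddle_def)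
  then show ?thesis
    using * by (intro exI[of _ \<sigma>]) (auto simp: saddle_def)
qed

theorem game_value:
  "\<exists>V. shapley P R \<gamma> \<beta>1 \<beta>2 V = V \<and>
    (\<forall>\<mu>1.
      has_maxmin (payoff \<mu>1) UNIV UNIV (\<Sum>x\<in>UNIV. pmf \<mu>1 x * V x) \<and>
      has_minmax (payoff \<mu>1) UNIV UNIV (\<Sum>x\<in>UNIV. pmf \<mu>1 x * V x) \<and>
      has_maxmin (payoff \<mu>1) stationary stationary (\<Sum>x\<in>UNIV. pmf \<mu>1 x * V x))"
proof -
  have "\<exists>s t. saddle (one_shot c) UNIV UNIV s t" for c
    using \<beta> by (intro ex_saddle_mixed_payoff) auto
  then obtain W \<sigma> \<tau> where
    sd: "\<And>h. saddle (one_shot (cont_payoff W h)) UNIV UNIV (\<sigma> h) (\<tau> h)"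
    and val: "\<And>h. one_shot (cont_payoff W h) (\<sigma> h) (\<tau> h) = W h"
    and dyn: "\<And>\<mu>1. saddle (payoff \<mu>1) {\<sigma>. \<forall>h. \<sigma> h \<in> UNIV} {\<tau>. \<forall>h. \<tau> h \<in> UNIV} \<sigma> \<tau>"
    and pay: "\<And>\<mu>1. payoff \<mu>1 \<sigma> \<tau> = (\<Sum>x\<in>UNIV. pmf \<mu>1 x * W ([], x))"
    and stat: "\<And>g x. W (g, x) = W ([], x)" "\<sigma> \<in> stationary" "\<tau> \<in> stationary"
    by (rule ex_dynamic_saddle[of "\<lambda>_. UNIV" "\<lambda>_. UNIV"]) (blast+)
  define V where "V x = W ([], x)" for x
  have W: "W = (\<lambda>h. V (snd h))"
    using stat(1) by (auto simp: V_def fun_eq_iff)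
  have "shapley P R \<gamma> \<beta>1 \<beta>2 V x = V x" for x
  proof -
    have loc: "local_payoff P R \<gamma> \<beta>1 \<beta>2 V x = one_shot (cont_payoff W ([], x))"
      unfolding W by (rule local_payoff_eq_one_shot)
    have "has_maxmin (one_shot (cont_payoff W ([], x))) UNIV UNIV (V x)"
      unfolding V_def val[of "([], x)", symmetric]
    proof (rule saddle_has_maxmin[OF sd])
      fix s
      show "\<exists>m. has_min (one_shot (cont_payoff W ([], x)) s) UNIV m"
        unfolding has_min_def using ex_one_shot_best_response2[of _ s] by blast
    qed
    then show ?thesis using has_maxmin_unique has_maxmin_shapley loc by metis
  qed
  moreover have sU: "saddle (payoff \<mu>1) UNIV UNIV \<sigma> \<tau>" for \<mu>1
    using dyn by simp
  moreover have sS: "saddle (payoff \<mu>1) stationary stationary \<sigma> \<tau>" for \<mu>1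
    using sU[of \<mu>1] stat by (simp add: saddle_def)
  have "has_maxmin (payoff \<mu>1) UNIV UNIV (payoff \<mu>1 \<sigma> \<tau>)" for \<mu>1
    by (rule saddle_has_maxmin[OF sU]) (use ex_best_response2[of \<mu>1] in \<open>force simp: has_min_def\<close>)
  moreover have "has_minmax (payoff \<mu>1) UNIV UNIV (payoff \<mu>1 \<sigma> \<tau>)" for \<mu>1
    by (rule saddle_has_minmax[OF sU]) (use ex_best_response1[of \<mu>1] in \<open>force simp: has_max_def\<close>)
  moreover have "has_maxmin (payoff \<mu>1) stationary stationary (payoff \<mu>1 \<sigma> \<tau>)" for \<mu>1
  proof (rule saddle_has_maxmin[OF sS])
    fix \<sigma>' :: "('x, 'u, 'w, 'u) strategy" assume "\<sigma>' \<in> stationary"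
    then show "\<exists>m. has_min (payoff \<mu>1 \<sigma>') stationary m"
      using ex_best_response2[of \<mu>1 \<sigma>'] by (force simp: has_min_def)
  qed
  ultimately show ?thesis
    unfolding pay V_def[symmetric] by (intro exI[of _ V]) auto
qed

end

theorem theorem2:
  fixes P :: "'x::finite \<Rightarrow> 'u::finite \<Rightarrow> 'w::finite \<Rightarrow> 'x pmf"
    and R :: "'x \<Rightarrow> 'u \<Rightarrow> 'w \<Rightarrow> real"
    and \<gamma> \<beta>1 \<beta>2 :: real
  assumes "0 < \<gamma>" "\<gamma> < 1" "0 < \<beta>1" "0 < \<beta>2"
  shows "\<exists>V :: 'x \<Rightarrow> real. shapley P R \<gamma> \<beta>1 \<beta>2 V = V \<and>
    (\<forall>\<mu>1 :: 'x pmf.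
      has_maxmin (discounted_payoff P R \<gamma> \<beta>1 \<beta>2 \<mu>1) UNIV UNIV (\<Sum>x\<in>UNIV. pmf \<mu>1 x * V x) \<and>
      has_minmax (discounted_payoff P R \<gamma> \<beta>1 \<beta>2 \<mu>1) UNIV UNIV (\<Sum>x\<in>UNIV. pmf \<mu>1 x * V x) \<and>
      has_maxmin (discounted_payoff P R \<gamma> \<beta>1 \<beta>2 \<mu>1) stationary stationary
        (\<Sum>x\<in>UNIV. pmf \<mu>1 x * V x))"
  by (rule entropy_game.game_value) (unfold_locales; fact)

end
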